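(* Let $\mathcal{P}$ be a finite-dimensional Poisson algebra over an arbitrary field $\mathbb{F}$. All maximal subalgebras of $\mathcal{P}$ are ideals of $\mathcal{P}$ if and only if $\mathcal{P}$ is nilpotent or $\mathcal{P}=\mathbb{F}e\oplus N$, where $e$ is an idempotent and $N$ is the nilradical of $\mathcal{P}$.
   Context: A Poisson algebra $(\mathcal{P},\cdot,[\cdot,\cdot])$ over $\mathbb{F}$ is a vector space with two bilinear products such that $(\mathcal{P},\cdot)$ is a commutative associative algebra (not necessarily unital), $(\mathcal{P},[\cdot,\cdot])$ is a Lie algebra, and $[x\cdot y,z]=[x,z]\cdot y+x\cdot[y,z]$ for all $x,y,z$. A subalgebra is a subspace closed under both products; a maximal subalgebra is a proper subalgebra maximal under inclusion; an ideal is a subspace $I$ with $I\cdot\mathcal{P}+[I,\mathcal{P}]\subseteq I$. A Poisson algebra $A$ is nilpotent if $A^m=0$ for some $m$, where $A^1=A$ and $A^{n+1}=\sum_{i=1}^{n}(A^i\cdot A^{n+1-i}+[A^i,A^{n+1-i}])$ (products of subspaces are linear spans). The nilradical is the largest nilpotent ideal of $\mathcal{P}$. An idempotent is an element $e$ with $e\cdot e=e$. The symbol $\oplus$ denotes an algebra direct sum: a vector space direct sum of ideals, so that all products (both $\cdot$ and $[\cdot,\cdot]$) between different summands are zero. *)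

theory Defs
  imports Complex_Main
begin

locale poisson_algebra = vector_space scale
  for scale :: "'f::field \<Rightarrow> 'a::ab_group_add \<Rightarrow> 'a" +
  fixes mult :: "'a \<Rightarrow> 'a \<Rightarrow> 'a"  (infixl "\<cdot>" 70)
    and bracket :: "'a \<Rightarrow> 'a \<Rightarrow> 'a"  ("\<lbrace>_, _\<rbrace>")
  assumes mult_linear_left: "Vector_Spaces.linear scale scale (\<lambda>x. x \<cdot> y)"
    and mult_linear_right: "Vector_Spaces.linear scale scale (\<lambda>y. x \<cdot> y)"
    and mult_assoc: "(x \<cdot> y) \<cdot> z = x \<cdot> (y \<cdot> z)"
    and mult_commute: "x \<cdot> y = y \<cdot> x"
    and bracket_linear_left: "Vector_Spaces.linear scale scale (\<lambda>x. \<lbrace>x, y\<rbrace>)"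
    and bracket_linear_right: "Vector_Spaces.linear scale scale (\<lambda>y. \<lbrace>x, y\<rbrace>)"
    and bracket_alternating: "\<lbrace>x, x\<rbrace> = 0"
    and jacobi: "\<lbrace>x, \<lbrace>y, z\<rbrace>\<rbrace> + \<lbrace>y, \<lbrace>z, x\<rbrace>\<rbrace> + \<lbrace>z, \<lbrace>x, y\<rbrace>\<rbrace> = 0"
    and leibniz: "\<lbrace>x \<cdot> y, z\<rbrace> = \<lbrace>x, z\<rbrace> \<cdot> y + x \<cdot> \<lbrace>y, z\<rbrace>"
begin

definition subalgebra :: "'a set \<Rightarrow> bool" where
  "subalgebra S \<longleftrightarrow> subspace S \<and> (\<forall>x\<in>S. \<forall>y\<in>S. x \<cdot> y \<in> S \<and> \<lbrace>x, y\<rbrace> \<in> S)"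

definition maximal_subalgebra :: "'a set \<Rightarrow> bool" where
  "maximal_subalgebra M \<longleftrightarrow> subalgebra M \<and> M \<noteq> UNIV \<and>
     (\<forall>S. subalgebra S \<and> M \<subseteq> S \<and> S \<noteq> UNIV \<longrightarrow> S = M)"

definition ideal :: "'a set \<Rightarrow> bool" where
  "ideal I \<longleftrightarrow> subspace I \<and> (\<forall>x\<in>I. \<forall>y. x \<cdot> y \<in> I \<and> \<lbrace>x, y\<rbrace> \<in> I)"

definition mult_space :: "'a set \<Rightarrow> 'a set \<Rightarrow> 'a set" where
  "mult_space X Y = span {x \<cdot> y | x y. x \<in> X \<and> y \<in> Y}"

definition bracket_space :: "'a set \<Rightarrow> 'a set \<Rightarrow> 'a set" where
  "bracket_space X Y = span {\<lbrace>x, y\<rbrace> | x y. x \<in> X \<and> y \<in> Y}"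

(* The second clause is the recursion for exponent Suc n + 1 = Suc (Suc n), so the first
   index i runs over 1..Suc n. The span of the union is the sum of the subspaces.
   The value at exponent 0 is a dummy. *)
fun alg_power :: "'a set \<Rightarrow> nat \<Rightarrow> 'a set" where
  "alg_power A 0 = A"
| "alg_power A (Suc 0) = A"
| "alg_power A (Suc (Suc n)) =
     span (\<Union>i\<in>{1..Suc n}.
       mult_space (alg_power A i) (alg_power A (Suc (Suc n) - i)) \<union>
       bracket_space (alg_power A i) (alg_power A (Suc (Suc n) - i)))"

(* Applied to subalgebras A, regarded as Poisson algebras in their own right. *)
definition nilpotent :: "'a set \<Rightarrow> bool" where
  "nilpotent A \<longleftrightarrow> (\<exists>m\<ge>1. alg_power A m = {0})"

definition is_nilradical :: "'a set \<Rightarrow> bool" where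
  "is_nilradical N \<longleftrightarrow> ideal N \<and> nilpotent N \<and> (\<forall>J. ideal J \<and> nilpotent J \<longrightarrow> J \<subseteq> N)"

definition idempotent :: "'a \<Rightarrow> bool" where
  "idempotent e \<longleftrightarrow> e \<cdot> e = e"

definition is_direct_sum :: "'a set \<Rightarrow> 'a set \<Rightarrow> bool" where
  "is_direct_sum I J \<longleftrightarrow> ideal I \<and> ideal J \<and> I \<inter> J = {0} \<and> {x + y | x y. x \<in> I \<and> y \<in> J} = UNIV"

lemma direct_sum_products_zero:
  assumes "is_direct_sum I J" and "x \<in> I" and "y \<in> J"
  shows "x \<cdot> y = 0" and "\<lbrace>x, y\<rbrace> = 0"
proof -
  have I: "ideal I" and J: "ideal J" and IJ: "I \<inter> J = {0}"
    using assms(1) by (auto simp: is_direct_sum_def)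
  have "x \<cdot> y \<in> I" "\<lbrace>x, y\<rbrace> \<in> I"
    using I assms(2) by (auto simp: ideal_def)
  moreover have "x \<cdot> y \<in> J"
    using J assms(3) by (metis ideal_def mult_commute)
  moreover have "\<lbrace>x, y\<rbrace> \<in> J"
  proof -
    interpret L: Vector_Spaces.linear scale scale "\<lambda>a. \<lbrace>a, x + y\<rbrace>"
      by (rule bracket_linear_left)
    interpret Rx: Vector_Spaces.linear scale scale "\<lambda>a. \<lbrace>x, a\<rbrace>"
      by (rule bracket_linear_right)
    interpret Ry: Vector_Spaces.linear scale scale "\<lambda>a. \<lbrace>y, a\<rbrace>"
      by (rule bracket_linear_right)
    have "\<lbrace>x + y, x + y\<rbrace> = \<lbrace>x, y\<rbrace> + \<lbrace>y, x\<rbrace>"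
      unfolding L.add Rx.add Ry.add by (simp add: bracket_alternating)
    then have "\<lbrace>x, y\<rbrace> = - \<lbrace>y, x\<rbrace>"
      by (simp add: bracket_alternating eq_neg_iff_add_eq_0)
    moreover have "\<lbrace>y, x\<rbrace> \<in> J" "subspace J"
      using J assms(3) by (auto simp: ideal_def)
    ultimately show ?thesis by (simp add: subspace_neg)
  qed
  ultimately show "x \<cdot> y = 0" and "\<lbrace>x, y\<rbrace> = 0" using IJ by blast+
qed

end

end

theory Submission
  imports Defs
begin

text \<open>
  Suppose first that every maximal subalgebra is an ideal. For a maximal ideal \<open>M\<close> and an element
  \<open>a\<close> outside it, the elements commuting with \<open>a\<close> modulo \<open>M\<close> form a subalgebra that contains \<open>M\<close>
  and \<open>a\<close>, hence everything; so all brackets lie in every maximal subalgebra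
  (\<open>bracket_in_maximal_ideal\<close>). By Fitting's lemma the algebra is the sum of the generalized
  \<open>0\<close>-eigenspace of \<open>ad x\<close>, which is a subalgebra because \<open>ad x\<close> is a derivation of both products,
  and a space of brackets. A maximal subalgebra containing that eigenspace would therefore be
  everything, so every \<open>ad x\<close> is nilpotent (\<open>ad_nilpotent_if_maximal_subalgebras_ideals\<close>).

  For the commutative product, an idempotent \<open>e\<close> is central for the bracket, so its annihilator
  \<open>N\<close> is an ideal and \<open>Fe + N\<close> is a subalgebra. An ideal containing it contains the products
  \<open>e \<cdot> y\<close> and so is everything; thus \<open>P = Fe \<oplus> N\<close> (\<open>mult_idempotent_in_line\<close>). Choose \<open>e\<close>
  nonzero when possible. A second idempotent \<open>f\<close> in \<open>N\<close> would make \<open>e\<close> a multiple of the idempotent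
  \<open>e + f\<close>, which is impossible; and a multiplication operator that is not nilpotent produces a
  nonzero idempotent (\<open>idempotent_if_mult_not_nilpotent\<close>). Hence all operators \<open>ad x\<close> and all
  multiplications by elements of \<open>N\<close> are nilpotent, and a Poisson version of Engel's theorem
  (\<open>nilpotent_if_operators_nilpotent\<close>) shows that \<open>N\<close> is nilpotent.

  Conversely let \<open>P = Fe \<oplus> N\<close> with \<open>N\<close> nilpotent; the case \<open>e = 0\<close> is that of a nilpotent \<open>P\<close>.
  If a maximal subalgebra \<open>M\<close> is not contained in \<open>N\<close>, it contains some \<open>e + n\<close>, and the powers of
  this element end at \<open>e\<close> because \<open>n\<close> is nilpotent; so either \<open>M = N\<close> or \<open>e \<in> M\<close>. In the second
  case \<open>M\<close> contains the square of \<open>N\<close>, for otherwise \<open>M \<inter> N\<close> would generate \<open>N\<close> modulo its square,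
  hence equal \<open>N\<close>. An \<open>M\<close> containing \<open>e\<close> and the square of \<open>N\<close> is an ideal
  (\<open>maximal_subalgebra_ideal_of_decomposition\<close>).
\<close>

section \<open>Bilinear calculus\<close>

context poisson_algebra
begin

lemma mult_distribs:
  "(x + y) \<cdot> z = x \<cdot> z + y \<cdot> z" "x \<cdot> (y + z) = x \<cdot> y + x \<cdot> z"
  "(x - y) \<cdot> z = x \<cdot> z - y \<cdot> z" "x \<cdot> (y - z) = x \<cdot> y - x \<cdot> z"
  "scale c x \<cdot> y = scale c (x \<cdot> y)" "x \<cdot> scale c y = scale c (x \<cdot> y)"
  "0 \<cdot> x = 0" "x \<cdot> 0 = 0"
proof -
  interpret L: Vector_Spaces.linear scale scale "\<lambda>a. a \<cdot> b" for b
    by (rule mult_linear_left)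
  interpret R: Vector_Spaces.linear scale scale "\<lambda>a. b \<cdot> a" for b
    by (rule mult_linear_right)
  show "(x + y) \<cdot> z = x \<cdot> z + y \<cdot> z" "x \<cdot> (y + z) = x \<cdot> y + x \<cdot> z"
    "(x - y) \<cdot> z = x \<cdot> z - y \<cdot> z" "x \<cdot> (y - z) = x \<cdot> y - x \<cdot> z"
    "scale c x \<cdot> y = scale c (x \<cdot> y)" "x \<cdot> scale c y = scale c (x \<cdot> y)"
    "0 \<cdot> x = 0" "x \<cdot> 0 = 0"
    by (rule L.add R.add L.diff R.diff L.scale R.scale L.zero R.zero)+
qed

lemma bracket_distribs:
  "\<lbrace>x + y, z\<rbrace> = \<lbrace>x, z\<rbrace> + \<lbrace>y, z\<rbrace>" "\<lbrace>x, y + z\<rbrace> = \<lbrace>x, y\<rbrace> + \<lbrace>x, z\<rbrace>"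
  "\<lbrace>x - y, z\<rbrace> = \<lbrace>x, z\<rbrace> - \<lbrace>y, z\<rbrace>" "\<lbrace>x, y - z\<rbrace> = \<lbrace>x, y\<rbrace> - \<lbrace>x, z\<rbrace>"
  "\<lbrace>scale c x, y\<rbrace> = scale c \<lbrace>x, y\<rbrace>" "\<lbrace>x, scale c y\<rbrace> = scale c \<lbrace>x, y\<rbrace>"
  "\<lbrace>0, x\<rbrace> = 0" "\<lbrace>x, 0\<rbrace> = 0"
  "\<lbrace>x, - y\<rbrace> = - \<lbrace>x, y\<rbrace>"
proof -
  interpret L: Vector_Spaces.linear scale scale "\<lambda>a. \<lbrace>a, b\<rbrace>" for b
    by (rule bracket_linear_left)
  interpret R: Vector_Spaces.linear scale scale "\<lambda>a. \<lbrace>b, a\<rbrace>" for b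
    by (rule bracket_linear_right)
  show "\<lbrace>x + y, z\<rbrace> = \<lbrace>x, z\<rbrace> + \<lbrace>y, z\<rbrace>" "\<lbrace>x, y + z\<rbrace> = \<lbrace>x, y\<rbrace> + \<lbrace>x, z\<rbrace>"
    "\<lbrace>x - y, z\<rbrace> = \<lbrace>x, z\<rbrace> - \<lbrace>y, z\<rbrace>" "\<lbrace>x, y - z\<rbrace> = \<lbrace>x, y\<rbrace> - \<lbrace>x, z\<rbrace>"
    "\<lbrace>scale c x, y\<rbrace> = scale c \<lbrace>x, y\<rbrace>" "\<lbrace>x, scale c y\<rbrace> = scale c \<lbrace>x, y\<rbrace>"
    "\<lbrace>0, x\<rbrace> = 0" "\<lbrace>x, 0\<rbrace> = 0" "\<lbrace>x, - y\<rbrace> = - \<lbrace>x, y\<rbrace>"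
    by (rule L.add R.add L.diff R.diff L.scale R.scale L.zero R.zero R.neg)+
qed

lemmas distribs = mult_distribs bracket_distribs

lemma bracket_skew: "\<lbrace>x, y\<rbrace> = - \<lbrace>y, x\<rbrace>"
proof -
  have "\<lbrace>x + y, x + y\<rbrace> = \<lbrace>x, y\<rbrace> + \<lbrace>y, x\<rbrace>"
    unfolding bracket_distribs by (simp add: bracket_alternating)
  then show ?thesis by (simp add: bracket_alternating eq_neg_iff_add_eq_0)
qed

lemma leibniz_right: "\<lbrace>x, y \<cdot> z\<rbrace> = \<lbrace>x, y\<rbrace> \<cdot> z + y \<cdot> \<lbrace>x, z\<rbrace>"
proof -
  have "\<lbrace>x, y \<cdot> z\<rbrace> = - (\<lbrace>y, x\<rbrace> \<cdot> z + y \<cdot> \<lbrace>z, x\<rbrace>)"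
    by (metis bracket_skew leibniz)
  also have "\<dots> = (0 - \<lbrace>y, x\<rbrace>) \<cdot> z + y \<cdot> (0 - \<lbrace>z, x\<rbrace>)"
    by (simp only: mult_distribs) simp
  also have "\<dots> = \<lbrace>x, y\<rbrace> \<cdot> z + y \<cdot> \<lbrace>x, z\<rbrace>"
    by (simp flip: bracket_skew[of x])
  finally show ?thesis .
qed

lemma bracket_derivation: "\<lbrace>x, \<lbrace>y, z\<rbrace>\<rbrace> = \<lbrace>\<lbrace>x, y\<rbrace>, z\<rbrace> + \<lbrace>y, \<lbrace>x, z\<rbrace>\<rbrace>"
proof -
  have "\<lbrace>y, \<lbrace>z, x\<rbrace>\<rbrace> = - \<lbrace>y, \<lbrace>x, z\<rbrace>\<rbrace>" "\<lbrace>z, \<lbrace>x, y\<rbrace>\<rbrace> = - \<lbrace>\<lbrace>x, y\<rbrace>, z\<rbrace>"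
    by (metis bracket_skew bracket_distribs(9)) (rule bracket_skew)
  with jacobi[of x y z] show ?thesis
    by (simp add: algebra_simps add_eq_0_iff)
qed

lemma subalgebraD:
  assumes "subalgebra S"
  shows "subspace S" "x \<in> S \<Longrightarrow> y \<in> S \<Longrightarrow> x \<cdot> y \<in> S" "x \<in> S \<Longrightarrow> y \<in> S \<Longrightarrow> \<lbrace>x, y\<rbrace> \<in> S"
  using assms by (auto simp: subalgebra_def)

lemma idealD:
  assumes "ideal I"
  shows "subspace I" "x \<in> I \<Longrightarrow> x \<cdot> y \<in> I" "x \<in> I \<Longrightarrow> y \<cdot> x \<in> I"
    "x \<in> I \<Longrightarrow> \<lbrace>x, y\<rbrace> \<in> I" "x \<in> I \<Longrightarrow> \<lbrace>y, x\<rbrace> \<in> I"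
proof -
  show "subspace I" "x \<in> I \<Longrightarrow> x \<cdot> y \<in> I" "x \<in> I \<Longrightarrow> y \<cdot> x \<in> I" "x \<in> I \<Longrightarrow> \<lbrace>x, y\<rbrace> \<in> I"
    using assms by (auto simp: ideal_def mult_commute[of y])
  then show "x \<in> I \<Longrightarrow> \<lbrace>y, x\<rbrace> \<in> I"
    by (metis bracket_skew subspace_neg)
qed

lemma ideal_imp_subalgebra: "ideal I \<Longrightarrow> subalgebra I"
  by (auto simp: ideal_def subalgebra_def)


section \<open>Powers of a subalgebra and the upper central series\<close>

lemma alg_power_1 [simp]: "alg_power A 1 = A"
  by simp

lemma subspace_alg_power:
  assumes "subspace A"
  shows "subspace (alg_power A n)"
  by (cases "(A, n)" rule: alg_power.cases) (use assms in \<open>auto simp: subspace_span\<close>)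

lemma alg_power_products:
  assumes "a \<in> alg_power A i" "b \<in> alg_power A j" "1 \<le> i" "1 \<le> j"
  shows "a \<cdot> b \<in> alg_power A (i + j)" "\<lbrace>a, b\<rbrace> \<in> alg_power A (i + j)"
proof -
  obtain n where n: "i + j = Suc (Suc n)"
    using assms(3,4) by (metis add_Suc add_Suc_right le_iff_add plus_1_eq_Suc)
  then have ij: "i \<in> {1..Suc n}" "j = Suc (Suc n) - i"
    using assms(3,4) by auto
  have "a \<cdot> b \<in> mult_space (alg_power A i) (alg_power A j)"
    "\<lbrace>a, b\<rbrace> \<in> bracket_space (alg_power A i) (alg_power A j)"
    unfolding mult_space_def bracket_space_def using assms(1,2) by (auto intro!: span_base)
  then show "a \<cdot> b \<in> alg_power A (i + j)" "\<lbrace>a, b\<rbrace> \<in> alg_power A (i + j)"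
    unfolding n alg_power.simps using ij by (auto intro!: span_base)
qed

text \<open>
  The form in which the recursion is used: to bound a power by a subspace, it suffices to look at
  the products that span it.
\<close>

lemma alg_power_subset:
  assumes "subspace T" "2 \<le> n"
    and "\<And>i j a b. 1 \<le> i \<Longrightarrow> 1 \<le> j \<Longrightarrow> i + j = n \<Longrightarrow> a \<in> alg_power A i \<Longrightarrow> b \<in> alg_power A j
           \<Longrightarrow> a \<cdot> b \<in> T \<and> \<lbrace>a, b\<rbrace> \<in> T"
  shows "alg_power A n \<subseteq> T"
proof -
  obtain k where n: "n = Suc (Suc k)"
    using assms(2) by (metis One_nat_def Suc_1 Suc_le_D Suc_le_mono)
  show ?thesis
    unfolding n alg_power.simps
  proof (intro span_minimal UN_least Un_least)
    fix i assume "i \<in> {1..Suc k}"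
    then have i: "1 \<le> i" "1 \<le> Suc (Suc k) - i" "i + (Suc (Suc k) - i) = n"
      using n by auto
    show "mult_space (alg_power A i) (alg_power A (Suc (Suc k) - i)) \<subseteq> T"
      "bracket_space (alg_power A i) (alg_power A (Suc (Suc k) - i)) \<subseteq> T"
      unfolding mult_space_def bracket_space_def
      by (rule span_minimal; use assms(3)[OF i] assms(1) in blast)+
  qed (rule assms(1))
qed

lemma alg_power_2_subset:
  assumes "subspace T" "\<And>a b. a \<in> A \<Longrightarrow> b \<in> A \<Longrightarrow> a \<cdot> b \<in> T \<and> \<lbrace>a, b\<rbrace> \<in> T"
  shows "alg_power A 2 \<subseteq> T"
proof (rule alg_power_subset[OF assms(1)])
  fix i j :: nat and a b
  assume "1 \<le> i" "1 \<le> j" "i + j = 2" and ab: "a \<in> alg_power A i" "b \<in> alg_power A j"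
  then have "i = 1" "j = 1" by simp_all
  with ab show "a \<cdot> b \<in> T \<and> \<lbrace>a, b\<rbrace> \<in> T" using assms(2) by simp
qed simp

text \<open>
  The analogue of the upper central series of a group. It serves as a flag that can be built upwards,
  whereas \<open>alg_power\<close> descends and mixes all bracketings.
\<close>

primrec upper_central :: "'a set \<Rightarrow> nat \<Rightarrow> 'a set" where
  "upper_central A 0 = {0}"
| "upper_central A (Suc k) =
     {w \<in> A. \<forall>a\<in>A. a \<cdot> w \<in> upper_central A k \<and> \<lbrace>a, w\<rbrace> \<in> upper_central A k}"

lemma subspace_upper_central:
  assumes "subspace A"
  shows "subspace (upper_central A k)"
proof (induction k)
  case 0
  show ?case by (simp add: subspace_0 subspace_def)
next
  case (Suc k)
  then show ?case using assms
    by (auto simp: subspace_def distribs)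
qed

lemma upper_central_subset:
  assumes "subspace A"
  shows "upper_central A k \<subseteq> A"
  using subspace_0[OF assms] by (cases k) auto

lemma upper_central_increasing:
  assumes "subalgebra A"
  shows "upper_central A k \<subseteq> upper_central A (Suc k)"
proof (induction k)
  case 0
  show ?case using subspace_0[OF subalgebraD(1)[OF assms]] by (auto simp: distribs)
next
  case (Suc k)
  then show ?case by auto
qed

lemma upper_central_invariant:
  assumes "subalgebra A" "a \<in> A" "w \<in> upper_central A k"
  shows "a \<cdot> w \<in> upper_central A k" "\<lbrace>a, w\<rbrace> \<in> upper_central A k"
  using upper_central_increasing[OF assms(1), of k] assms(2,3) by auto

text \<open>
  By definition one factor from \<open>A\<close> lowers the level in the central series by one. Products of
  degree \<open>i\<close> lower it by \<open>i\<close>, however they are bracketed, since associativity, the Leibniz rule and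
  the Jacobi identity express the action of a product by compositions of the actions of its factors.
\<close>

lemma alg_power_lowers_upper_central:
  assumes A: "subalgebra A" and "1 \<le> i" "a \<in> alg_power A i" "z \<in> upper_central A (i + j)"
  shows "a \<cdot> z \<in> upper_central A j" "\<lbrace>a, z\<rbrace> \<in> upper_central A j"
proof -
  note sub = subspace_upper_central[OF subalgebraD(1)[OF A]]
  have "\<forall>a\<in>alg_power A i. \<forall>j. \<forall>z\<in>upper_central A (i + j).
          a \<cdot> z \<in> upper_central A j \<and> \<lbrace>a, z\<rbrace> \<in> upper_central A j"
    using \<open>1 \<le> i\<close>
  proof (induction i rule: less_induct)
    case (less i)
    show ?case
    proof (cases "i = 1")
      case True
      then show ?thesis by auto
    next
      case False
      then have "2 \<le> i" using less.prems by simp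
      let ?T = "{a. \<forall>j. \<forall>z\<in>upper_central A (i + j).
                  a \<cdot> z \<in> upper_central A j \<and> \<lbrace>a, z\<rbrace> \<in> upper_central A j}"
      have "alg_power A i \<subseteq> ?T"
      proof (rule alg_power_subset[OF _ \<open>2 \<le> i\<close>])
        show "subspace ?T"
          using sub by (auto simp: subspace_def distribs)
        fix r s p q
        assume rs: "1 \<le> r" "1 \<le> s" "r + s = i" and p: "p \<in> alg_power A r" and q: "q \<in> alg_power A s"
        have P: "p \<cdot> z \<in> upper_central A j" "\<lbrace>p, z\<rbrace> \<in> upper_central A j"
          if "z \<in> upper_central A (r + j)" for j z
          using less.IH[of r] rs p that by auto
        have Q: "q \<cdot> z \<in> upper_central A j" "\<lbrace>q, z\<rbrace> \<in> upper_central A j"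
          if "z \<in> upper_central A (s + j)" for j z
          using less.IH[of s] rs q that by auto
        (* Apply the action of one factor to land at level s + j or r + j, then that of the other. *)
        have "(p \<cdot> q) \<cdot> z \<in> upper_central A j \<and> \<lbrace>p \<cdot> q, z\<rbrace> \<in> upper_central A j \<and>
            \<lbrace>p, q\<rbrace> \<cdot> z \<in> upper_central A j \<and> \<lbrace>\<lbrace>p, q\<rbrace>, z\<rbrace> \<in> upper_central A j"
          if "z \<in> upper_central A (i + j)" for j z
        proof -
          have z: "z \<in> upper_central A (r + (s + j))" "z \<in> upper_central A (s + (r + j))"
            using that rs by (simp_all add: ac_simps)
          have "\<lbrace>p \<cdot> q, z\<rbrace> = q \<cdot> \<lbrace>p, z\<rbrace> + p \<cdot> \<lbrace>q, z\<rbrace>"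
            by (simp add: leibniz mult_commute)
          moreover have "\<lbrace>p, q\<rbrace> \<cdot> z = \<lbrace>p, q \<cdot> z\<rbrace> - q \<cdot> \<lbrace>p, z\<rbrace>"
            by (simp add: leibniz_right)
          moreover have "\<lbrace>\<lbrace>p, q\<rbrace>, z\<rbrace> = \<lbrace>p, \<lbrace>q, z\<rbrace>\<rbrace> - \<lbrace>q, \<lbrace>p, z\<rbrace>\<rbrace>"
            by (simp add: bracket_derivation[of p q z])
          ultimately show ?thesis
            using P Q z by (auto simp: mult_assoc intro!: subspace_add[OF sub] subspace_diff[OF sub])
        qed
        then show "p \<cdot> q \<in> ?T \<and> \<lbrace>p, q\<rbrace> \<in> ?T" by blast
      qed
      then show ?thesis by blast
    qed
  qed
  with assms(3,4) show "a \<cdot> z \<in> upper_central A j" "\<lbrace>a, z\<rbrace> \<in> upper_central A j"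
    by blast+
qed

text \<open>
  If the central series reaches \<open>A\<close> at level \<open>n\<close>, then a product of degree \<open>k\<close> lies \<open>k - 1\<close>
  levels below \<open>A\<close>: its first factor, of degree \<open>i\<close>, lowers the level of the second by \<open>i\<close>.
\<close>

lemma nilpotent_if_upper_central_exhausts:
  assumes A: "subalgebra A" and n: "upper_central A n = A"
  shows "nilpotent A"
proof -
  have "alg_power A k \<subseteq> upper_central A j" if "1 \<le> k" "k + j = Suc n" for k j
    using that
  proof (induction k arbitrary: j rule: less_induct)
    case (less k)
    show ?case
    proof (cases "k = 1")
      case True
      then show ?thesis using less.prems n by simp
    next
      case False
      then have "2 \<le> k" using less.prems by simp
      show ?thesis
      proof (rule alg_power_subset[OF _ \<open>2 \<le> k\<close>])
        show "subspace (upper_central A j)"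
          by (rule subspace_upper_central[OF subalgebraD(1)[OF A]])
        fix i l a b
        assume il: "1 \<le> i" "1 \<le> l" "i + l = k" and ab: "a \<in> alg_power A i" "b \<in> alg_power A l"
        have "b \<in> upper_central A (i + j)"
          using less.IH[of l "i + j"] il ab less.prems by auto
        then show "a \<cdot> b \<in> upper_central A j \<and> \<lbrace>a, b\<rbrace> \<in> upper_central A j"
          using alg_power_lowers_upper_central[OF A] il ab by blast
      qed
    qed
  qed
  from this[of "Suc n" 0] have "alg_power A (Suc n) \<subseteq> {0}" by simp
  moreover have "0 \<in> alg_power A (Suc n)"
    using subspace_0 subspace_alg_power subalgebraD(1)[OF A] by blast
  ultimately show ?thesis
    unfolding nilpotent_def by (intro exI[of _ "Suc n"]) auto
qed

lemma iterated_mult_in_alg_power: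
  assumes "n \<in> A"
  shows "((mult n) ^^ k) n \<in> alg_power A (Suc k)"
proof (induction k)
  case 0
  show ?case using assms by simp
next
  case (Suc k)
  then have "n \<cdot> ((mult n) ^^ k) n \<in> alg_power A (1 + Suc k)"
    using assms by (intro alg_power_products) auto
  then show ?case by simp
qed

lemma idempotent_in_nilpotent:
  assumes "nilpotent A" "e \<in> A" "e \<cdot> e = e"
  shows "e = 0"
proof -
  obtain m where m: "1 \<le> m" "alg_power A m = {0}"
    using assms(1) by (auto simp: nilpotent_def)
  then obtain k where k: "m = Suc k"
    by (metis Suc_le_D One_nat_def)
  have "((mult e) ^^ k) e = e"
    by (induction k) (auto simp: assms(3))
  then show ?thesis
    using iterated_mult_in_alg_power[OF assms(2), of k] m k by auto
qed


section \<open>Maximal subalgebras of a line plus a nilpotent ideal\<close>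

text \<open>
  Nilpotent algebras satisfy a Nakayama lemma. Writing both factors of a product as an element of
  \<open>S\<close> plus an error in the \<open>k\<close>-th power, all terms with an error lie in the next power; so
  \<open>N = S + N\<^sup>k\<close> improves to \<open>N = S + N\<^sup>2 = S + N\<^sup>k\<^sup>+\<^sup>1\<close>, until the power vanishes.
\<close>

lemma nilpotent_generated_modulo_square:
  assumes N: "subalgebra N" "nilpotent N" and S: "subalgebra S" "S \<subseteq> N"
    and gen: "\<And>n. n \<in> N \<Longrightarrow> \<exists>s\<in>S. n - s \<in> alg_power N 2"
  shows "S = N"
proof -
  have sN: "subspace (alg_power N k)" for k
    using N(1) by (intro subspace_alg_power subalgebraD(1))
  note sS = subalgebraD(1)[OF S(1)]
  have step: "\<forall>n\<in>N. \<exists>s\<in>S. n - s \<in> alg_power N (Suc k)" for k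
  proof (induction k)
    case 0
    then show ?case
      using subspace_0[OF sS] by (intro ballI bexI[of _ 0]) auto
  next
    case (Suc k)
    let ?T = "{s + q | s q. s \<in> S \<and> q \<in> alg_power N (Suc (Suc k))}"
    have sT: "subspace ?T"
      by (rule subspace_sums[OF sS sN])
    have "alg_power N 2 \<subseteq> ?T"
    proof (rule alg_power_2_subset[OF sT])
      fix a b assume ab: "a \<in> N" "b \<in> N"
      obtain s t where st: "s \<in> S" "a - s \<in> alg_power N (Suc k)" "t \<in> S" "b - t \<in> alg_power N (Suc k)"
        using Suc.IH ab by meson
      have 1: "(a - s) \<cdot> b \<in> alg_power N (Suc k + 1)" "\<lbrace>a - s, b\<rbrace> \<in> alg_power N (Suc k + 1)"
        "s \<cdot> (b - t) \<in> alg_power N (1 + Suc k)" "\<lbrace>s, b - t\<rbrace> \<in> alg_power N (1 + Suc k)"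
        by (rule alg_power_products; use st ab S(2) in auto)+
      have "a \<cdot> b = s \<cdot> t + ((a - s) \<cdot> b + s \<cdot> (b - t))"
        "\<lbrace>a, b\<rbrace> = \<lbrace>s, t\<rbrace> + (\<lbrace>a - s, b\<rbrace> + \<lbrace>s, b - t\<rbrace>)"
        by (simp_all add: distribs)
      moreover have "s \<cdot> t \<in> S" "\<lbrace>s, t\<rbrace> \<in> S"
        using st subalgebraD(2,3)[OF S(1)] by auto
      moreover have "(a - s) \<cdot> b + s \<cdot> (b - t) \<in> alg_power N (Suc (Suc k))"
        "\<lbrace>a - s, b\<rbrace> + \<lbrace>s, b - t\<rbrace> \<in> alg_power N (Suc (Suc k))"
        using 1 by (auto intro!: subspace_add[OF sN] simp del: alg_power.simps)
      ultimately show "a \<cdot> b \<in> ?T \<and> \<lbrace>a, b\<rbrace> \<in> ?T" by blast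
    qed
    show ?case
    proof
      fix n assume "n \<in> N"
      then obtain s where s: "s \<in> S" "n - s \<in> alg_power N 2" using gen by blast
      then obtain t q where tq: "t \<in> S" "q \<in> alg_power N (Suc (Suc k))" "n - s = t + q"
        using \<open>alg_power N 2 \<subseteq> ?T\<close> by blast
      then have "s + t \<in> S" "n - (s + t) = q"
        using s subspace_add[OF sS] by (auto simp: algebra_simps)
      with tq show "\<exists>s\<in>S. n - s \<in> alg_power N (Suc (Suc k))" by blast
    qed
  qed
  obtain m where m: "1 \<le> m" "alg_power N m = {0}"
    using N(2) by (auto simp: nilpotent_def)
  then obtain k where "m = Suc k"
    by (metis Suc_le_D One_nat_def)
  with step[of k] m have "N \<subseteq> S" by auto
  with S(2) show ?thesis by blast
qed

text \<open>
  The idempotent may be \<open>0\<close>, so that nilpotent algebras are included. The proof distinguishes whether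
  \<open>M\<close> contains \<open>e\<close>; if it does not, it lies in \<open>N\<close>, because the powers of an element \<open>e + p\<close> with \<open>p\<close>
  nilpotent end at \<open>e\<close>.
\<close>

lemma maximal_subalgebra_ideal_of_decomposition:
  assumes e: "e \<cdot> e = e" and N: "ideal N" "nilpotent N"
    and ds: "is_direct_sum (span {e}) N" and M: "maximal_subalgebra M"
  shows "ideal M"
proof -
  have eN: "e \<cdot> n = 0" "n \<cdot> e = 0" "\<lbrace>e, n\<rbrace> = 0" "\<lbrace>n, e\<rbrace> = 0" if "n \<in> N" for n
    using direct_sum_products_zero[OF ds _ that, of e] mult_commute[of n] bracket_skew[of n]
    by (auto intro: span_base)
  have decomp: "\<exists>c n. n \<in> N \<and> y = scale c e + n" for y
    using ds unfolding is_direct_sum_def span_singleton by blast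
  have Msub: "subalgebra M" and Mne: "M \<noteq> UNIV"
    and Mmax: "\<And>S. subalgebra S \<Longrightarrow> M \<subseteq> S \<Longrightarrow> S = M \<or> S = UNIV"
    using M by (auto simp: maximal_subalgebra_def)
  note sM = subalgebraD(1)[OF Msub]
  note sN = idealD(1)[OF N(1)]
  have Nsub: "subalgebra N" by (rule ideal_imp_subalgebra[OF N(1)])
  show ?thesis
  proof (cases "e \<in> M")
    case True
    show ?thesis
    proof (cases "alg_power N 2 \<subseteq> M")
      case sq: True
      have sqM: "n \<cdot> n' \<in> M" "\<lbrace>n, n'\<rbrace> \<in> M" if "n \<in> N" "n' \<in> N" for n n'
        using alg_power_products[of n N 1 n' 1] that sq by (auto simp: numeral_2_eq_2)
      show ?thesis
        unfolding ideal_def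
      proof (intro conjI ballI allI sM)
        fix m y assume m: "m \<in> M"
        obtain c n where n: "n \<in> N" "m = scale c e + n" using decomp by blast
        obtain d p where p: "p \<in> N" "y = scale d e + p" using decomp by blast
        have "m \<cdot> y = scale (c * d) e + n \<cdot> p" "\<lbrace>m, y\<rbrace> = \<lbrace>n, p\<rbrace>"
          using n p eN by (simp_all add: distribs e bracket_alternating mult.commute)
        then show "m \<cdot> y \<in> M" "\<lbrace>m, y\<rbrace> \<in> M"
          using sqM n(1) p(1) True subspace_add[OF sM] subspace_scale[OF sM] by auto
      qed
    next
      case False
      (* The square Q of N is an ideal, so M + Q is a subalgebra properly containing M. *)
      let ?Q = "alg_power N 2"
      have sQ: "subspace ?Q" by (rule subspace_alg_power[OF sN])
      have QN: "?Q \<subseteq> N"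
        by (rule alg_power_2_subset[OF sN]) (auto intro: idealD[OF N(1)])
      have Qid: "ideal ?Q"
        unfolding ideal_def
      proof (intro conjI ballI allI sQ)
        fix q y assume q: "q \<in> ?Q"
        obtain d p where p: "p \<in> N" "y = scale d e + p" using decomp by blast
        have "q \<cdot> y = q \<cdot> p" "\<lbrace>q, y\<rbrace> = \<lbrace>q, p\<rbrace>"
          using q QN p eN by (auto simp: distribs)
        then show "q \<cdot> y \<in> ?Q" "\<lbrace>q, y\<rbrace> \<in> ?Q"
          using alg_power_products[of q N 1 p 1] q p QN by (auto simp: numeral_2_eq_2)
      qed
      let ?S = "{m + q | m q. m \<in> M \<and> q \<in> ?Q}"
      have "subalgebra ?S"
        unfolding subalgebra_def
      proof (intro conjI ballI subspace_sums[OF sM sQ])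
        fix x y assume "x \<in> ?S" "y \<in> ?S"
        then obtain m q m' q' where
          mq: "m \<in> M" "q \<in> ?Q" "m' \<in> M" "q' \<in> ?Q" and xy: "x = m + q" "y = m' + q'"
          by blast
        have "x \<cdot> y = m \<cdot> m' + (m \<cdot> q' + q \<cdot> y)" "\<lbrace>x, y\<rbrace> = \<lbrace>m, m'\<rbrace> + (\<lbrace>m, q'\<rbrace> + \<lbrace>q, y\<rbrace>)"
          by (simp_all add: xy distribs)
        moreover have "m \<cdot> q' + q \<cdot> y \<in> ?Q" "\<lbrace>m, q'\<rbrace> + \<lbrace>q, y\<rbrace> \<in> ?Q"
          using mq idealD[OF Qid] subspace_add[OF sQ] by auto
        moreover have "m \<cdot> m' \<in> M" "\<lbrace>m, m'\<rbrace> \<in> M"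
          using mq subalgebraD[OF Msub] by auto
        ultimately show "x \<cdot> y \<in> ?S" "\<lbrace>x, y\<rbrace> \<in> ?S" by blast+
      qed
      moreover have "M \<subseteq> ?S" "?Q \<subseteq> ?S"
        using subspace_0[OF sQ] subspace_0[OF sM] by force+
      ultimately have S: "?S = UNIV"
        using Mmax False by blast
      have "M \<inter> N = N"
      proof (rule nilpotent_generated_modulo_square[OF Nsub N(2)])
        show "subalgebra (M \<inter> N)"
          using Msub Nsub by (auto simp: subalgebra_def subspace_inter)
        fix n assume n: "n \<in> N"
        obtain m q where mq: "m \<in> M" "q \<in> ?Q" "n = m + q" using S by blast
        then have "m = n - q" by simp
        then have "m \<in> N" using n mq(2) QN subspace_diff[OF sN] by blast
        with mq show "\<exists>s\<in>M \<inter> N. n - s \<in> ?Q"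
          by (intro bexI[of _ m]) simp_all
      qed simp
      then show ?thesis using QN False by blast
    qed
  next
    case False
    have "M \<subseteq> N"
    proof
      fix m assume m: "m \<in> M"
      obtain c n where n: "n \<in> N" "m = scale c e + n" using decomp by blast
      show "m \<in> N"
      proof (cases "c = 0")
        case True
        then show ?thesis using n by simp
      next
        case c: False
        (* Rescaling m gives an element e + p of M, whose powers are e plus the powers of p. *)
        define p where "p = scale (inverse c) n"
        define x where "x = scale (inverse c) m"
        have p: "p \<in> N" and x: "x \<in> M"
          using n m subspace_scale[OF sN] subspace_scale[OF sM] by (auto simp: p_def x_def)
        have xp: "x = e + p"
          using c by (simp add: x_def p_def n(2) scale_right_distrib)
        have pN: "((mult p) ^^ k) p \<in> N" for k
          using p by (induction k) (auto intro: idealD[OF N(1)])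
        have "((mult x) ^^ k) x = e + ((mult p) ^^ k) p" for k
        proof (induction k)
          case (Suc k)
          then show ?case
            using eN pN[of k] p by (simp add: distribs xp e)
        qed (simp add: xp)
        moreover have "((mult x) ^^ k) x \<in> M" for k
          using x by (induction k) (auto intro: subalgebraD[OF Msub])
        ultimately have inM: "e + ((mult p) ^^ k) p \<in> M" for k by metis
        obtain l where "1 \<le> l" "alg_power N l = {0}"
          using N(2) by (auto simp: nilpotent_def)
        then obtain k where "alg_power N (Suc k) = {0}"
          by (metis Suc_le_D One_nat_def)
        then have "((mult p) ^^ k) p = 0"
          using iterated_mult_in_alg_power[OF p, of k] by auto
        with inM[of k] False show ?thesis by simp
      qed
    qed
    moreover have "N \<noteq> UNIV"
    proof
      assume "N = UNIV"
      then have "e = 0" using idempotent_in_nilpotent[OF N(2) _ e] by auto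
      with False subspace_0[OF sM] show False by simp
    qed
    ultimately have "N = M" using Mmax[OF Nsub] by blast
    with N(1) show ?thesis by simp
  qed
qed

end


section \<open>Fitting decomposition and maximal subalgebras in finite dimension\<close>

text \<open>
  Engel-type arguments below are carried out for pairs \<open>U \<subset> W\<close> of invariant spaces instead of a
  quotient space. This is the corresponding form of the fact that a nilpotent operator has a nonzero
  kernel: the last iterate that is still outside \<open>U\<close> works.
\<close>

lemma last_iterate_outside:
  assumes "(f ^^ n) w \<in> U" "w \<in> W" "w \<notin> U" "\<And>x. x \<in> W \<Longrightarrow> f x \<in> W"
  obtains v where "v \<in> W" "v \<notin> U" "f v \<in> U"
proof -
  have "\<exists>v. v \<in> W \<and> v \<notin> U \<and> f v \<in> U"
    using assms(1-3)
  proof (induction n arbitrary: w)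
    case (Suc n)
    show ?case
    proof (cases "f w \<in> U")
      case False
      then show ?thesis
        using Suc assms(4)[of w] by (simp add: funpow_Suc_right del: funpow.simps)
    qed (use Suc in blast)
  qed simp
  then show ?thesis using that by blast
qed

locale fd_poisson_algebra =
  poisson_algebra scale mult bracket + finite_dimensional_vector_space scale Basis
  for scale :: "'f::field \<Rightarrow> 'a::ab_group_add \<Rightarrow> 'a"
    and mult :: "'a \<Rightarrow> 'a \<Rightarrow> 'a"  (infixl "\<cdot>" 70)
    and bracket :: "'a \<Rightarrow> 'a \<Rightarrow> 'a"  ("\<lbrace>_, _\<rbrace>")
    and Basis :: "'a set"
begin

lemma exists_max_dim:
  assumes "P (S :: 'a set)"
  shows "\<exists>K. P K \<and> (\<forall>T. P T \<longrightarrow> dim T \<le> dim K)"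
proof -
  have "\<forall>T. P T \<longrightarrow> dim T < Suc (dim UNIV)"
    using dim_subset[OF subset_UNIV] by (simp add: less_Suc_eq_le)
  from ex_has_greatest_nat[of P S dim, OF assms this] show ?thesis .
qed

lemma subalgebra_in_maximal:
  assumes "subalgebra S" "S \<noteq> UNIV"
  obtains M where "maximal_subalgebra M" "S \<subseteq> M"
proof -
  obtain M where M: "subalgebra M" "S \<subseteq> M" "M \<noteq> UNIV"
    and max: "\<And>T. subalgebra T \<and> S \<subseteq> T \<and> T \<noteq> UNIV \<Longrightarrow> dim T \<le> dim M"
    using exists_max_dim[of "\<lambda>T. subalgebra T \<and> S \<subseteq> T \<and> T \<noteq> UNIV" S] assms by auto
  have "maximal_subalgebra M"
    unfolding maximal_subalgebra_def
  proof (intro conjI allI impI M)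
    fix T assume T: "subalgebra T \<and> M \<subseteq> T \<and> T \<noteq> UNIV"
    then have "dim T \<le> dim M" using max M by blast
    then show "T = M"
      using subspace_dim_equal[of M T] T M(1) subalgebraD(1) by blast
  qed
  with M that show ?thesis by blast
qed

lemma linear_funpow:
  assumes "Vector_Spaces.linear scale scale f"
  shows "Vector_Spaces.linear scale scale (f ^^ n)"
proof (induction n)
  case 0
  show ?case using linear_ident by simp
next
  case (Suc n)
  then show ?case
    using Vector_Spaces.linear_compose[OF Suc assms] by (simp only: funpow.simps)
qed

lemma range_funpow_stabilizes:
  assumes f: "Vector_Spaces.linear scale scale f"
  shows "\<exists>n\<ge>1. \<forall>m\<ge>n. range (f ^^ m) = range (f ^^ n)"
proof -
  obtain n where n: "1 \<le> n" "\<And>m. 1 \<le> m \<Longrightarrow> dim (range (f ^^ n)) \<le> dim (range (f ^^ m))"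
    using ex_has_least_nat[of "\<lambda>n. (1::nat) \<le> n" 1 "\<lambda>n. dim (range (f ^^ n))"] by blast
  have sub: "subspace (range (f ^^ m))" for m
  proof -
    interpret L: Vector_Spaces.linear scale scale "f ^^ m"
      by (rule linear_funpow[OF f])
    show ?thesis by (rule L.subspace_image[OF subspace_UNIV])
  qed
  have "range (f ^^ m) = range (f ^^ n)" if "n \<le> m" for m
  proof (rule subspace_dim_equal[OF sub sub])
    show "range (f ^^ m) \<subseteq> range (f ^^ n)"
      using that by (auto simp: funpow_add dest!: le_Suc_ex)
    show "dim (range (f ^^ n)) \<le> dim (range (f ^^ m))"
      using n that by auto
  qed
  with n(1) show ?thesis by blast
qed

end

context poisson_algebra
begin

text \<open>
  The two bilinear maps to which this is applied are the product and the bracket. Induction on the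
  total \<open>m + n\<close> replaces the binomial formula for \<open>D\<^sup>k\<close> of a product.
\<close>

lemma derivation_iterates_kill_products:
  assumes D: "\<And>x y. D (x + y) = D x + D y" "D 0 = 0"
    and B: "\<And>x y. D (B x y) = B (D x) y + B x (D y)" "\<And>y. B 0 y = 0" "\<And>x. B x 0 = 0"
    and "(D ^^ m) a = 0" "(D ^^ n) b = 0"
  shows "(D ^^ (m + n)) (B a b) = (0 :: 'a)"
proof -
  have Dn: "(D ^^ k) (x + y) = (D ^^ k) x + (D ^^ k) y" "(D ^^ k) 0 = 0" for k x y
    by (induction k) (auto simp: D)
  show ?thesis
    using assms(6,7)
  proof (induction "m + n" arbitrary: m n a b)
    case 0
    then show ?case by (simp add: B)
  next
    case (Suc k)
    show ?case
    proof (cases "m = 0 \<or> n = 0")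
      case True
      then have "B a b = 0" using Suc.prems B by auto
      then show ?thesis by (simp add: Dn)
    next
      case False
      then obtain m' n' where mn: "m = Suc m'" "n = Suc n'"
        by (metis not0_implies_Suc)
      have "(D ^^ (m' + n)) (B (D a) b) = 0" "(D ^^ (m + n')) (B a (D b)) = 0"
        using Suc.hyps(1)[of m' n "D a" b] Suc.hyps(1)[of m n' a "D b"] Suc.hyps(2) Suc.prems mn
        by (simp_all add: funpow_Suc_right del: funpow.simps)
      moreover have "m + n = Suc (m' + n)" "m' + n = m + n'" using mn by auto
      ultimately show ?thesis
        by (simp add: funpow_Suc_right B Dn del: funpow.simps)
    qed
  qed
qed

lemma fitting_null_component_subalgebra:
  "subalgebra {y. \<exists>n. ((bracket x) ^^ n) y = 0}"
proof -
  let ?D = "bracket x"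
  have Dn: "(?D ^^ k) (y + z) = (?D ^^ k) y + (?D ^^ k) z" "(?D ^^ k) 0 = 0"
    "(?D ^^ k) (scale c y) = scale c ((?D ^^ k) y)" for k y z c
    by (induction k) (auto simp: distribs)
  have later: "(?D ^^ (k + n)) y = 0" if "(?D ^^ n) y = 0" for k n y
    using that by (simp add: funpow_add Dn)
  show ?thesis
    unfolding subalgebra_def
  proof (intro conjI ballI)
    show "subspace {y. \<exists>n. (?D ^^ n) y = 0}"
    proof (rule subspaceI)
      fix y z assume "y \<in> {y. \<exists>n. (?D ^^ n) y = 0}" "z \<in> {y. \<exists>n. (?D ^^ n) y = 0}"
      then obtain m n where "(?D ^^ m) y = 0" "(?D ^^ n) z = 0" by blast
      then have "(?D ^^ (m + n)) (y + z) = 0"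
        using later[of m y n] later[of n z m] by (simp add: Dn add.commute)
      then show "y + z \<in> {y. \<exists>n. (?D ^^ n) y = 0}" by blast
    qed (auto simp: Dn)
    fix y z assume "y \<in> {y. \<exists>n. (?D ^^ n) y = 0}" "z \<in> {y. \<exists>n. (?D ^^ n) y = 0}"
    then obtain m n where mn: "(?D ^^ m) y = 0" "(?D ^^ n) z = 0" by blast
    have "(?D ^^ (m + n)) (y \<cdot> z) = 0"
      by (rule derivation_iterates_kill_products[of ?D "(\<cdot>)", OF _ _ _ _ _ mn])
        (simp_all add: distribs leibniz_right)
    moreover have "(?D ^^ (m + n)) \<lbrace>y, z\<rbrace> = 0"
      by (rule derivation_iterates_kill_products[of ?D bracket, OF _ _ _ _ _ mn])
        (simp_all add: distribs flip: bracket_derivation)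
    ultimately show "y \<cdot> z \<in> {y. \<exists>n. (?D ^^ n) y = 0}" "\<lbrace>y, z\<rbrace> \<in> {y. \<exists>n. (?D ^^ n) y = 0}"
      by blast+
  qed
qed

text \<open>
  For \<open>a\<close> outside \<open>M\<close>, the elements that commute with \<open>a\<close> modulo \<open>M\<close> form a subalgebra, since
  \<open>ad a\<close> is a derivation of both products and \<open>M\<close> is an ideal. It contains \<open>M\<close> and \<open>a\<close>, and
  maximality applies.
\<close>

lemma bracket_in_maximal_ideal:
  assumes M: "maximal_subalgebra M" "ideal M"
  shows "\<lbrace>a, y\<rbrace> \<in> M"
proof (cases "a \<in> M")
  case True
  then show ?thesis using idealD[OF M(2)] by blast
next
  case False
  let ?C = "{y. \<lbrace>a, y\<rbrace> \<in> M}"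
  note sM = idealD(1)[OF M(2)]
  have "subalgebra ?C"
    unfolding subalgebra_def
  proof (intro conjI ballI)
    show "subspace ?C"
      using sM by (auto simp: subspace_def distribs)
    fix y z assume "y \<in> ?C" "z \<in> ?C"
    then show "y \<cdot> z \<in> ?C" "\<lbrace>y, z\<rbrace> \<in> ?C"
      using idealD[OF M(2)] subspace_add[OF sM]
      by (auto simp: leibniz_right bracket_derivation[of a y z])
  qed
  moreover have "M \<subseteq> ?C" using idealD[OF M(2)] by blast
  moreover have "a \<in> ?C" using subspace_0[OF sM] by (simp add: bracket_alternating)
  ultimately have "?C = UNIV"
    using M(1) False unfolding maximal_subalgebra_def by blast
  then show ?thesis by blast
qed

end

context fd_poisson_algebra
begin

text \<open>
  Otherwise the generalized \<open>0\<close>-eigenspace of \<open>ad x\<close> lies in some maximal subalgebra \<open>M\<close>. By Fitting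
  it is complemented by a range consisting of brackets, which also lie in \<open>M\<close>.
  Nilpotency is stated pointwise, with an exponent depending on \<open>y\<close>; Engel's argument applies the
  operators to one vector at a time.
\<close>

lemma ad_nilpotent_if_maximal_subalgebras_ideals:
  assumes max: "\<And>M. maximal_subalgebra M \<Longrightarrow> ideal M"
  shows "\<exists>n. ((bracket x) ^^ n) y = 0"
proof (rule ccontr)
  let ?D = "bracket x" and ?K = "{y. \<exists>n. ((bracket x) ^^ n) y = 0}"
  assume "\<nexists>n. (?D ^^ n) y = 0"
  then have "?K \<noteq> UNIV" by blast
  then obtain M where M: "maximal_subalgebra M" "?K \<subseteq> M"
    by (rule subalgebra_in_maximal[OF fitting_null_component_subalgebra])
  obtain n where n: "1 \<le> n" "\<And>m. n \<le> m \<Longrightarrow> range (?D ^^ m) = range (?D ^^ n)"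
    using range_funpow_stabilizes[OF bracket_linear_right[of x]] by blast
  have sM: "subspace M" using idealD(1)[OF max[OF M(1)]] .
  have "y \<in> M" for y
  proof -
    interpret L: Vector_Spaces.linear scale scale "?D ^^ n"
      by (rule linear_funpow[OF bracket_linear_right])
    (* Fitting: y = (y - w) + w, where w in the stable range has the same n-th iterate as y. *)
    obtain z where z: "(?D ^^ n) y = (?D ^^ (n + n)) z"
      using n(2)[of "n + n"] by (metis le_add1 rangeE rangeI)
    define w where "w = (?D ^^ n) z"
    have "(?D ^^ n) (y - w) = 0"
      using z by (simp add: L.diff w_def funpow_add)
    then have "y - w \<in> M" using M(2) by blast
    moreover have "w \<in> M"
    proof -
      obtain k where "n = Suc k" using n(1) by (metis Suc_le_D One_nat_def)
      then have "w = \<lbrace>x, (?D ^^ k) z\<rbrace>" by (simp add: w_def)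
      then show ?thesis using bracket_in_maximal_ideal[OF M(1) max[OF M(1)]] by simp
    qed
    ultimately show ?thesis using subspace_add[OF sM] by fastforce
  qed
  with M(1) show False unfolding maximal_subalgebra_def by blast
qed

text \<open>
  Multiplication by \<open>x\<close> is onto on the stable range \<open>V\<close> of its iterates, and so is multiplication by
  \<open>p = x\<^sup>n\<^sup>+\<^sup>1\<close>, which itself belongs to \<open>V\<close>. An element \<open>u\<close> of \<open>V\<close> with \<open>p \<cdot> u = p\<close> then acts as the
  identity on \<open>V = p \<cdot> V\<close>; in particular it is idempotent.
\<close>

lemma idempotent_if_mult_not_nilpotent:
  assumes "\<And>n. ((mult x) ^^ n) y \<noteq> 0"
  obtains z where "(x \<cdot> z) \<cdot> (x \<cdot> z) = x \<cdot> z" "x \<cdot> z \<noteq> 0"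
proof -
  let ?L = "mult x"
  obtain n where n: "1 \<le> n" "\<And>m. n \<le> m \<Longrightarrow> range (?L ^^ m) = range (?L ^^ n)"
    using range_funpow_stabilizes[OF mult_linear_right[of x]] by blast
  define p where "p = (?L ^^ n) x"
  have "(?L ^^ k) x \<cdot> z = (?L ^^ (Suc k)) z" for k z
    by (induction k) (auto simp: mult_assoc)
  then have p: "p \<cdot> z = (?L ^^ (Suc n)) z" for z
    by (simp add: p_def)
  obtain v where "p = (?L ^^ (Suc n + n)) v"
    using n(2)[of "Suc n + n"] by (metis p_def le_add2 rangeE rangeI)
  then have pu: "p \<cdot> (?L ^^ n) v = p"
    using p[of "(?L ^^ n) v"] by (simp only: funpow_add o_apply)
  define u where "u = (?L ^^ n) v"
  have id: "u \<cdot> (?L ^^ n) w = (?L ^^ n) w" for w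
  proof -
    obtain w' where "(?L ^^ n) w = (?L ^^ (Suc n)) w'"
      using n(2)[of "Suc n"] by (metis le_SucI order_refl rangeE rangeI)
    then have "(?L ^^ n) w = p \<cdot> w'" by (simp add: p)
    then show ?thesis
      using pu by (metis u_def mult_assoc mult_commute)
  qed
  obtain k where "n = Suc k" using n(1) by (metis Suc_le_D One_nat_def)
  then have u: "u = x \<cdot> (?L ^^ k) v" by (simp add: u_def)
  have "u \<cdot> u = u" using id[of v] by (simp add: u_def)
  moreover have "u \<noteq> 0"
    using id[of y] assms[of n] by (auto simp: distribs)
  ultimately show ?thesis using that u by metis
qed


section \<open>Engel's theorem for Poisson algebras\<close>

text \<open>
  The classical induction for Engel's theorem. A proper Lie subalgebra \<open>K\<close> of \<open>H\<close> of largest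
  dimension is normalized by some \<open>h\<close> outside it, by induction for the pair \<open>K \<subset> H\<close>; so \<open>H\<close> is \<open>K\<close>
  plus the line through \<open>h\<close>. By induction for \<open>U \<subset> W\<close>, the space of \<open>w \<in> W\<close> that \<open>K\<close> maps into \<open>U\<close>
  is larger than \<open>U\<close>; it is invariant under \<open>ad h\<close>, which is nilpotent. The pair \<open>U \<subset> W\<close> is
  general because the induction uses two different pairs.
\<close>

lemma engel_bracket:
  assumes "subspace H" "\<And>x y. x \<in> H \<Longrightarrow> y \<in> H \<Longrightarrow> \<lbrace>x, y\<rbrace> \<in> H"
    and "\<And>x y. x \<in> H \<Longrightarrow> \<exists>n. ((bracket x) ^^ n) y = 0"
    and "subspace U" "subspace W" "U \<subset> W"
    and "\<And>h u. h \<in> H \<Longrightarrow> u \<in> U \<Longrightarrow> \<lbrace>h, u\<rbrace> \<in> U"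
    and "\<And>h w. h \<in> H \<Longrightarrow> w \<in> W \<Longrightarrow> \<lbrace>h, w\<rbrace> \<in> W"
  shows "\<exists>v\<in>W - U. \<forall>h\<in>H. \<lbrace>h, v\<rbrace> \<in> U"
  using assms
proof (induction "dim H" arbitrary: H U W rule: less_induct)
  case less
  note sH = \<open>subspace H\<close> and sU = \<open>subspace U\<close> and sW = \<open>subspace W\<close>
  show ?case
  proof (cases "H = {0}")
    case True
    then show ?thesis
      using less.prems(6) subspace_0[OF sU] by (auto simp: distribs)
  next
    case False
    let ?P = "\<lambda>K. subspace K \<and> K \<subset> H \<and> (\<forall>x\<in>K. \<forall>y\<in>K. \<lbrace>x, y\<rbrace> \<in> K)"
    have "?P {0}"
      using False subspace_0[OF sH] by (auto simp: subspace_def distribs)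
    then obtain K where K: "?P K" and Kmax: "\<And>T. ?P T \<Longrightarrow> dim T \<le> dim K"
      using exists_max_dim[of ?P "{0}"] by auto
    have sK: "subspace K" and KH: "K \<subseteq> H" and KneH: "K \<noteq> H"
      and KK: "\<And>x y. x \<in> K \<Longrightarrow> y \<in> K \<Longrightarrow> \<lbrace>x, y\<rbrace> \<in> K"
      using K by auto
    have dimK: "dim K < dim H"
      using subspace_dim_equal[OF sK sH KH] KneH not_le by blast
    have nilK: "\<exists>n. ((bracket x) ^^ n) y = 0" if "x \<in> K" for x y
      using less.prems(3) that KH by blast
    have "\<exists>h\<in>H - K. \<forall>k\<in>K. \<lbrace>k, h\<rbrace> \<in> K"
    proof (rule less.hyps[OF dimK sK KK nilK sK sH])
      show "K \<subset> H" using KH KneH by blast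
      show "\<lbrace>h, w\<rbrace> \<in> H" if "h \<in> K" "w \<in> H" for h w
        using less.prems(2) KH that by blast
    qed (use KK in blast)+
    then obtain h where h: "h \<in> H" "h \<notin> K" "\<And>k. k \<in> K \<Longrightarrow> \<lbrace>k, h\<rbrace> \<in> K" by blast
    let ?S = "{k + q | k q. k \<in> K \<and> q \<in> span {h}}"
    have sS: "subspace ?S" by (rule subspace_sums[OF sK subspace_span])
    have KS: "K \<subseteq> ?S" and hS: "h \<in> ?S"
      using span_zero[of "{h}"] span_base[of h "{h}"] subspace_0[OF sK] by force+
    have SH: "?S \<subseteq> H"
      using KH h(1) by (auto simp: span_singleton intro!: subspace_add[OF sH] subspace_scale[OF sH])
    have "\<lbrace>x, y\<rbrace> \<in> ?S" if xy: "x \<in> ?S" "y \<in> ?S" for x y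
    proof -
      obtain k c k' c' where k: "k \<in> K" "k' \<in> K" "x = k + scale c h" "y = k' + scale c' h"
        using xy by (auto simp: span_singleton)
      have "\<lbrace>h, k'\<rbrace> \<in> K"
        using h(3)[OF k(2)] by (metis bracket_skew subspace_neg[OF sK])
      then have "\<lbrace>k, k'\<rbrace> + (scale c' \<lbrace>k, h\<rbrace> + scale c \<lbrace>h, k'\<rbrace>) \<in> K"
        using K k h(3) by (intro subspace_add[OF sK] subspace_scale[OF sK]) auto
      moreover have "\<lbrace>x, y\<rbrace> = \<lbrace>k, k'\<rbrace> + (scale c' \<lbrace>k, h\<rbrace> + scale c \<lbrace>h, k'\<rbrace>)"
        by (simp add: k distribs bracket_alternating)
      ultimately show ?thesis using KS by auto
    qed
    moreover have "dim K < dim ?S"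
      using subspace_dim_equal[OF sK sS KS] hS h(2) not_le by blast
    ultimately have HS: "H = ?S"
      using Kmax[of ?S] sS SH not_le by (auto simp del: mem_Collect_eq)
    let ?W = "{w \<in> W. \<forall>k\<in>K. \<lbrace>k, w\<rbrace> \<in> U}"
    have "\<exists>w\<in>W - U. \<forall>k\<in>K. \<lbrace>k, w\<rbrace> \<in> U"
      using KH by (intro less.hyps[OF dimK sK KK nilK sU sW less.prems(6)] less.prems(7,8)) auto
    then obtain w where w: "w \<in> ?W" "w \<notin> U" by blast
    have hW: "\<lbrace>h, w\<rbrace> \<in> ?W" if w: "w \<in> ?W" for w
    proof -
      have "\<lbrace>k, \<lbrace>h, w\<rbrace>\<rbrace> \<in> U" if k: "k \<in> K" for k
      proof -
        have "\<lbrace>\<lbrace>k, h\<rbrace>, w\<rbrace> \<in> U" "\<lbrace>h, \<lbrace>k, w\<rbrace>\<rbrace> \<in> U"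
          using w k h less.prems(7) by auto
        then show ?thesis
          unfolding bracket_derivation[of k h w] by (rule subspace_add[OF sU])
      qed
      then show ?thesis using w h(1) less.prems(8) by auto
    qed
    obtain n where "((bracket h) ^^ n) w = 0" using less.prems(3) h(1) by blast
    then have "((bracket h) ^^ n) w \<in> U" using subspace_0[OF sU] by simp
    then obtain v where v: "v \<in> ?W" "v \<notin> U" "\<lbrace>h, v\<rbrace> \<in> U"
      by (rule last_iterate_outside[OF _ w hW])
    have "\<lbrace>g, v\<rbrace> \<in> U" if "g \<in> H" for g
    proof -
      have "g \<in> ?S" using that HS by blast
      then obtain k c where "k \<in> K" "g = k + scale c h"
        by (auto simp: span_singleton)
      then show ?thesis
        using v by (auto simp: distribs intro!: subspace_add[OF sU] subspace_scale[OF sU])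
    qed
    with v show ?thesis by blast
  qed
qed

text \<open>
  Multiplications commute, so a common vector is found by treating one generator after the other.
\<close>

lemma engel_mult:
  assumes "finite B" "\<And>b y. b \<in> B \<Longrightarrow> \<exists>n. ((mult b) ^^ n) y = 0"
    and U: "subspace U" "U \<subset> W" "\<And>b u. b \<in> B \<Longrightarrow> u \<in> U \<Longrightarrow> b \<cdot> u \<in> U"
    and "\<And>b w. b \<in> B \<Longrightarrow> w \<in> W \<Longrightarrow> b \<cdot> w \<in> W"
  shows "\<exists>v\<in>W - U. \<forall>b\<in>B. b \<cdot> v \<in> U"
  using assms(1,2,5,6)
proof (induction B)
  case empty
  then show ?case using U(2) by blast
next
  case (insert b B)
  let ?W = "{w \<in> W. \<forall>b\<in>B. b \<cdot> w \<in> U}"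
  obtain w where w: "w \<in> ?W" "w \<notin> U" using insert by blast
  have bW: "b \<cdot> w \<in> ?W" if "w \<in> ?W" for w
  proof -
    have "b' \<cdot> (b \<cdot> w) \<in> U" if "b' \<in> B" for b'
    proof -
      have "b' \<cdot> (b \<cdot> w) = b \<cdot> (b' \<cdot> w)" by (metis mult_assoc mult_commute)
      then show ?thesis using insert.prems(2) \<open>w \<in> ?W\<close> that by auto
    qed
    then show ?thesis using that insert.prems(3) by auto
  qed
  obtain n where "((mult b) ^^ n) w = 0" using insert.prems(1) by blast
  then have "((mult b) ^^ n) w \<in> U" using subspace_0[OF U(1)] by simp
  then obtain v where "v \<in> ?W" "v \<notin> U" "b \<cdot> v \<in> U"
    by (rule last_iterate_outside[OF _ w bW])
  then show ?case by blast
qed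

text \<open>
  The two kinds of operators are treated in turn: the space of all \<open>w \<in> W\<close> that multiplication by \<open>A\<close>
  maps into \<open>U\<close> is larger than \<open>U\<close> by the commutative case, and by the Leibniz rule it is invariant
  under the bracket with \<open>A\<close>, so the Lie case applies to it.
\<close>

lemma engel_poisson:
  assumes A: "subalgebra A"
    and nil: "\<And>x y. x \<in> A \<Longrightarrow> \<exists>n. ((bracket x) ^^ n) y = 0"
      "\<And>x y. x \<in> A \<Longrightarrow> \<exists>n. ((mult x) ^^ n) y = 0"
    and sU: "subspace U" and sW: "subspace W" and UW: "U \<subset> W"
    and U: "\<And>a u. a \<in> A \<Longrightarrow> u \<in> U \<Longrightarrow> a \<cdot> u \<in> U \<and> \<lbrace>a, u\<rbrace> \<in> U"
    and W: "\<And>a w. a \<in> A \<Longrightarrow> w \<in> W \<Longrightarrow> a \<cdot> w \<in> W \<and> \<lbrace>a, w\<rbrace> \<in> W"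
  shows "\<exists>v\<in>W - U. \<forall>a\<in>A. a \<cdot> v \<in> U \<and> \<lbrace>a, v\<rbrace> \<in> U"
proof -
  let ?W = "{w \<in> W. \<forall>a\<in>A. a \<cdot> w \<in> U}"
  obtain B where B: "B \<subseteq> A" "independent B" "A \<subseteq> span B"
    by (rule basis_exists[of A])
  have "\<exists>v\<in>W - U. \<forall>b\<in>B. b \<cdot> v \<in> U"
  proof (rule engel_mult[OF finiteI_independent[OF B(2)] _ sU UW])
    show "\<exists>n. ((mult b) ^^ n) y = 0" if "b \<in> B" for b y
      using nil(2) B(1) that by blast
  qed (use B(1) U W in auto)
  then obtain v where v: "v \<in> W - U" "\<forall>b\<in>B. b \<cdot> v \<in> U" by blast
  have "subspace {a. a \<cdot> v \<in> U}"
    using sU by (auto simp: subspace_def distribs)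
  then have "span B \<subseteq> {a. a \<cdot> v \<in> U}"
    using v(2) by (intro span_minimal) auto
  then have "v \<in> ?W" using v(1) B(3) by blast
  then have UW': "U \<subset> ?W" using v(1) UW U by blast
  have sW': "subspace ?W"
    using sU sW by (auto simp: subspace_def distribs)
  have invW': "\<lbrace>a, w\<rbrace> \<in> ?W" if a: "a \<in> A" and w: "w \<in> ?W" for a w
  proof -
    have "x \<cdot> \<lbrace>a, w\<rbrace> \<in> U" if x: "x \<in> A" for x
    proof -
      have "\<lbrace>a, x \<cdot> w\<rbrace> \<in> U" "\<lbrace>a, x\<rbrace> \<cdot> w \<in> U"
        using U a x w subalgebraD(3)[OF A] by auto
      moreover have "x \<cdot> \<lbrace>a, w\<rbrace> = \<lbrace>a, x \<cdot> w\<rbrace> - \<lbrace>a, x\<rbrace> \<cdot> w"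
        by (simp add: leibniz_right)
      ultimately show ?thesis using subspace_diff[OF sU] by simp
    qed
    then show ?thesis using W a w by blast
  qed
  have "\<exists>v\<in>?W - U. \<forall>a\<in>A. \<lbrace>a, v\<rbrace> \<in> U"
    by (rule engel_bracket[OF subalgebraD(1,3)[OF A] nil(1) sU sW' UW' _ invW'])
      (simp_all add: U)
  then show ?thesis by blast
qed

text \<open>
  Engel's theorem makes the upper central series increase strictly until it reaches \<open>A\<close>, which happens
  by finite dimension.
\<close>

lemma nilpotent_if_operators_nilpotent:
  assumes A: "subalgebra A"
    and nil: "\<And>x y. x \<in> A \<Longrightarrow> \<exists>n. ((bracket x) ^^ n) y = 0"
      "\<And>x y. x \<in> A \<Longrightarrow> \<exists>n. ((mult x) ^^ n) y = 0"
  shows "nilpotent A"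
proof -
  note sA = subalgebraD(1)[OF A]
  let ?Z = "upper_central A"
  obtain n where n: "\<And>m. dim (?Z m) \<le> dim (?Z n)"
  proof -
    have "\<exists>n. True \<and> (\<forall>m. True \<longrightarrow> dim (?Z m) \<le> dim (?Z n))"
      by (rule ex_has_greatest_nat[of _ 0 _ "Suc (dim A)"])
        (simp_all add: dim_subset upper_central_subset[OF sA] less_Suc_eq_le)
    then show ?thesis using that by blast
  qed
  have "?Z n = A"
  proof (rule ccontr)
    assume "?Z n \<noteq> A"
    then have "?Z n \<subset> A" using upper_central_subset[OF sA] by blast
    then have "\<exists>v\<in>A - ?Z n. \<forall>a\<in>A. a \<cdot> v \<in> ?Z n \<and> \<lbrace>a, v\<rbrace> \<in> ?Z n"
      using subalgebraD[OF A] upper_central_invariant[OF A]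
      by (intro engel_poisson[OF A nil subspace_upper_central[OF sA] sA]) auto
    then obtain v where v: "v \<in> ?Z (Suc n)" "v \<notin> ?Z n" by auto
    then show False
      using subspace_dim_equal[OF subspace_upper_central[OF sA] subspace_upper_central[OF sA]
          upper_central_increasing[OF A] n[of "Suc n"]] by blast
  qed
  then show ?thesis by (rule nilpotent_if_upper_central_exhausts[OF A])
qed


end

section \<open>Idempotents when all maximal subalgebras are ideals\<close>

context poisson_algebra
begin

text \<open>
  Applying \<open>ad z\<close> to \<open>e \<cdot> e = e\<close> gives \<open>\<lbrace>e, z\<rbrace> = 2w\<close> with \<open>w = e \<cdot> \<lbrace>e, z\<rbrace>\<close>, and multiplying by \<open>e\<close>
  gives \<open>w = 2w\<close>, so \<open>w = 0\<close>.
\<close>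

lemma idempotent_central:
  assumes e: "e \<cdot> e = e"
  shows "\<lbrace>e, z\<rbrace> = 0"
proof -
  define w where "w = e \<cdot> \<lbrace>e, z\<rbrace>"
  have "\<lbrace>e, z\<rbrace> = \<lbrace>e, z\<rbrace> \<cdot> e + e \<cdot> \<lbrace>e, z\<rbrace>"
    using leibniz[of e e z] unfolding e .
  also have "\<dots> = w + w" by (simp add: w_def mult_commute)
  finally have ez: "\<lbrace>e, z\<rbrace> = w + w" .
  have "e \<cdot> w = w" by (simp add: w_def e flip: mult_assoc)
  moreover have "w = e \<cdot> (w + w)" by (subst ez[symmetric]) (rule w_def)
  ultimately have "w = w + w" unfolding mult_distribs by metis
  then have "w = 0" by simp
  with ez show ?thesis by simp
qed

lemma annihilator_of_idempotent_ideal: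
  assumes e: "e \<cdot> e = e"
  shows "ideal {x. e \<cdot> x = 0}"
proof -
  have "e \<cdot> \<lbrace>x, y\<rbrace> = \<lbrace>e \<cdot> x, y\<rbrace>" for x y
    by (simp add: leibniz idempotent_central[OF e] distribs)
  then show ?thesis
    unfolding ideal_def by (auto simp: subspace_def distribs simp flip: mult_assoc)
qed

end

context fd_poisson_algebra
begin

text \<open>
  The line through \<open>e\<close> and the annihilator of \<open>e\<close> span a subalgebra. An ideal containing it contains
  \<open>e \<cdot> y\<close> and \<open>y - e \<cdot> y\<close> for every \<open>y\<close>, so it cannot be a proper maximal subalgebra.
\<close>

lemma mult_idempotent_in_line:
  assumes max: "\<And>M. maximal_subalgebra M \<Longrightarrow> ideal M" and e: "e \<cdot> e = e"
  shows "e \<cdot> y \<in> span {e}"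
proof -
  let ?N = "{x. e \<cdot> x = 0}"
  have N: "ideal ?N" by (rule annihilator_of_idempotent_ideal[OF e])
  let ?S = "{x + n | x n. x \<in> span {e} \<and> n \<in> ?N}"
  have S_form: "\<exists>c n. z = scale c e + n \<and> n \<in> ?N" if "z \<in> ?S" for z
    using that unfolding span_singleton by blast
  have sub: "subalgebra ?S"
    unfolding subalgebra_def
  proof (intro conjI ballI subspace_sums[OF subspace_span idealD(1)[OF N]])
    fix x y assume xy: "x \<in> ?S" "y \<in> ?S"
    obtain c n where x: "x = scale c e + n" "n \<in> ?N" using S_form[OF xy(1)] by blast
    obtain d p where y: "y = scale d e + p" "p \<in> ?N" using S_form[OF xy(2)] by blast
    have ep: "e \<cdot> p = 0" "n \<cdot> e = 0" "\<lbrace>e, p\<rbrace> = 0" "\<lbrace>n, e\<rbrace> = 0"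
      using x y idempotent_central[OF e] bracket_skew[of n e] by (auto simp: mult_commute)
    have "x \<cdot> y = scale (d * c) e + n \<cdot> p" "\<lbrace>x, y\<rbrace> = 0 + \<lbrace>n, p\<rbrace>"
      using ep by (simp_all add: x y distribs e bracket_alternating)
    moreover have "n \<cdot> p \<in> ?N" "\<lbrace>n, p\<rbrace> \<in> ?N"
      using idealD(2,4)[OF N x(2)] by blast+
    moreover have "scale (d * c) e \<in> span {e}" "0 \<in> span {e}"
      by (simp_all add: span_scale span_base span_zero)
    ultimately show "x \<cdot> y \<in> ?S" "\<lbrace>x, y\<rbrace> \<in> ?S"
      by blast+
  qed
  have eS: "e \<in> ?S"
    by (intro CollectI exI[of _ e] exI[of _ 0]) (simp add: distribs span_base)
  have NS: "?N \<subseteq> ?S"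
  proof
    fix n assume "n \<in> ?N"
    then show "n \<in> ?S"
      by (intro CollectI exI[of _ 0] exI[of _ n]) (simp add: span_zero)
  qed
  have "?S = UNIV"
  proof (rule ccontr)
    assume "?S \<noteq> UNIV"
    then obtain M where M: "maximal_subalgebra M" "?S \<subseteq> M"
      by (rule subalgebra_in_maximal[OF sub])
    note id = idealD[OF max[OF M(1)]]
    have "y \<in> M" for y
    proof -
      have "e \<cdot> y \<in> M" by (rule id(2)) (use eS M(2) in blast)
      moreover have "y - e \<cdot> y \<in> ?N"
        by (simp add: distribs e flip: mult_assoc)
      then have "y - e \<cdot> y \<in> M" using NS M(2) by blast
      ultimately show ?thesis
        using subspace_add[OF id(1), of "e \<cdot> y" "y - e \<cdot> y"] by simp
    qed
    then have "M = UNIV" by blast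
    with M(1) show False unfolding maximal_subalgebra_def by simp
  qed
  then have "y \<in> ?S" by blast
  then obtain c n where "y = scale c e + n" "e \<cdot> n = 0"
    using S_form[of y] by blast
  then show ?thesis by (simp add: distribs e span_scale span_base)
qed

text \<open>
  With \<open>e = 0\<close> allowed, this also covers nilpotent algebras, whose decomposition is \<open>{0} \<oplus> P\<close>.
  The ideal \<open>N\<close> absorbs every nilpotent ideal \<open>J\<close>: an element of \<open>J\<close> with a nonzero component along
  \<open>e\<close> would force the idempotent \<open>e\<close> into \<open>J\<close>.
\<close>

lemma decomposition_if_maximal_subalgebras_ideals:
  assumes max: "\<And>M. maximal_subalgebra M \<Longrightarrow> ideal M"
  shows "\<exists>e N. idempotent e \<and> is_nilradical N \<and> is_direct_sum (span {e}) N"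
proof -
  have line: "\<exists>c. e \<cdot> y = scale c e" if "e \<cdot> e = e" for e y
    using mult_idempotent_in_line[OF max that, of y] by (auto simp: span_singleton)
  obtain e where e: "e \<cdot> e = e" and e_choice: "e \<noteq> 0 \<or> (\<forall>f. f \<cdot> f = f \<longrightarrow> f = 0)"
    using mult_distribs(7) by blast
  define N where "N = {x. e \<cdot> x = 0}"
  have idN: "ideal N"
    unfolding N_def by (rule annihilator_of_idempotent_ideal[OF e])
  (* If e is nonzero, e + f is a nonzero idempotent, so e = (e + f) e is a multiple c (e + f);
     multiplying by f gives c f = 0 and hence e = c e, so that c = 1 and f = 0. *)
  have no_idem: "f = 0" if f: "f \<in> N" "f \<cdot> f = f" for f
  proof (cases "e = 0")
    case False
    have ef: "e \<cdot> f = 0" "f \<cdot> e = 0" using f by (auto simp: N_def mult_commute)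
    have "(e + f) \<cdot> (e + f) = e + f" by (simp add: distribs e f ef)
    then obtain c where "(e + f) \<cdot> e = scale c (e + f)" using line by blast
    then have ec: "e = scale c e + scale c f"
      by (simp add: distribs e ef scale_right_distrib)
    then have "f \<cdot> e = f \<cdot> (scale c e + scale c f)" by simp
    then have "scale c f = 0" by (simp add: distribs ef f)
    with ec False show ?thesis by auto
  qed (use e_choice f in blast)
  have nilN: "nilpotent N"
  proof (rule nilpotent_if_operators_nilpotent[OF ideal_imp_subalgebra[OF idN]])
    show "\<exists>n. ((bracket x) ^^ n) y = 0" for x y
      by (rule ad_nilpotent_if_maximal_subalgebras_ideals[OF max])
    show "\<exists>n. ((mult x) ^^ n) y = 0" if "x \<in> N" for x y
    proof (rule ccontr)
      assume "\<nexists>n. ((mult x) ^^ n) y = 0"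
      then have "((mult x) ^^ n) y \<noteq> 0" for n by blast
      then obtain z where "(x \<cdot> z) \<cdot> (x \<cdot> z) = x \<cdot> z" "x \<cdot> z \<noteq> 0"
        by (rule idempotent_if_mult_not_nilpotent)
      with no_idem idealD(2)[OF idN that] show False by blast
    qed
  qed
  have "J \<subseteq> N" if J: "ideal J" "nilpotent J" for J
  proof
    fix j assume j: "j \<in> J"
    obtain c where c: "e \<cdot> j = scale c e" using line[OF e] by blast
    show "j \<in> N"
    proof (cases "c = 0")
      case True
      with c show ?thesis by (simp add: N_def)
    next
      case False
      have "scale (inverse c) (e \<cdot> j) \<in> J"
        using j idealD[OF J(1)] subspace_scale by blast
      then have "e \<in> J" using c False by simp
      then have "e = 0" by (rule idempotent_in_nilpotent[OF J(2) _ e])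
      then show ?thesis by (simp add: N_def distribs)
    qed
  qed
  then have "is_nilradical N" using idN nilN by (auto simp: is_nilradical_def)
  moreover have "is_direct_sum (span {e}) N"
    unfolding is_direct_sum_def
  proof (intro conjI idN)
    show "ideal (span {e})"
      unfolding ideal_def
    proof (intro conjI ballI allI subspace_span)
      fix x y assume "x \<in> span {e}"
      then obtain d where d: "x = scale d e" by (auto simp: span_singleton)
      obtain c where "e \<cdot> y = scale c e" using line[OF e] by blast
      then show "x \<cdot> y \<in> span {e}" "\<lbrace>x, y\<rbrace> \<in> span {e}"
        by (auto simp: d distribs idempotent_central[OF e] span_zero span_base intro!: span_scale)
    qed
    show "span {e} \<inter> N = {0}"
      by (auto simp: span_singleton N_def distribs e span_zero intro: rev_image_eqI[of 0])
    have "\<exists>x n. y = x + n \<and> x \<in> span {e} \<and> n \<in> N" for y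
    proof (intro exI conjI)
      show "y = e \<cdot> y + (y - e \<cdot> y)" by simp
      show "e \<cdot> y \<in> span {e}" by (rule mult_idempotent_in_line[OF max e])
      show "y - e \<cdot> y \<in> N" by (simp add: N_def distribs e flip: mult_assoc)
    qed
    then show "{x + y |x y. x \<in> span {e} \<and> y \<in> N} = UNIV" by blast
  qed
  ultimately show ?thesis using e by (auto simp: idempotent_def)
qed

lemma maximal_subalgebras_ideals_iff:
  "(\<forall>M. maximal_subalgebra M \<longrightarrow> ideal M) \<longleftrightarrow>
     (nilpotent UNIV \<or> (\<exists>e N. idempotent e \<and> is_nilradical N \<and> is_direct_sum (span {e}) N))"
proof
  assume "\<forall>M. maximal_subalgebra M \<longrightarrow> ideal M"
  then show "nilpotent UNIV \<or> (\<exists>e N. idempotent e \<and> is_nilradical N \<and> is_direct_sum (span {e}) N)"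
    using decomposition_if_maximal_subalgebras_ideals by blast
next
  assume "nilpotent UNIV \<or> (\<exists>e N. idempotent e \<and> is_nilradical N \<and> is_direct_sum (span {e}) N)"
  then obtain e N where "e \<cdot> e = e" "ideal N" "nilpotent N" "is_direct_sum (span {e}) N"
  proof (elim disjE exE conjE)
    assume nil: "nilpotent UNIV"
    have "span {0} = {0}" by (simp add: span_singleton)
    then have "is_direct_sum (span {0}) UNIV"
      by (auto simp: is_direct_sum_def ideal_def subspace_def distribs)
    with nil that[of 0 UNIV] show thesis
      by (simp add: distribs ideal_def subspace_UNIV)
  qed (use that in \<open>auto simp: idempotent_def is_nilradical_def\<close>)
  then show "\<forall>M. maximal_subalgebra M \<longrightarrow> ideal M"
    using maximal_subalgebra_ideal_of_decomposition by blast
qed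

end

theorem theorem4p9:
  fixes scale :: "'f::field \<Rightarrow> 'a::ab_group_add \<Rightarrow> 'a"
    and mult bracket :: "'a \<Rightarrow> 'a \<Rightarrow> 'a"
    and Basis :: "'a set"
  assumes "poisson_algebra scale mult bracket"
    and "finite_dimensional_vector_space scale Basis"
  shows "(\<forall>M. poisson_algebra.maximal_subalgebra scale mult bracket M \<longrightarrow>
             poisson_algebra.ideal scale mult bracket M) \<longleftrightarrow>
         (poisson_algebra.nilpotent scale mult bracket UNIV \<or>
          (\<exists>e N. poisson_algebra.idempotent mult e \<and>
                 poisson_algebra.is_nilradical scale mult bracket N \<and>
                 poisson_algebra.is_direct_sum scale mult bracket (module.span scale {e}) N))"
proof -
  interpret fd_poisson_algebra scale mult bracket Basis
    using assms by (rule fd_poisson_algebra.intro)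
  show ?thesis by (rule maximal_subalgebras_ideals_iff)
qed

end
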